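(* Let $W$ be a bounded operator on $\mathcal H$ and let $\chi,\chi'$ be partitions of $\mathcal X$. If $\chi'$ is a subpartition of $\chi$, then $\mathcal M_{\chi'}(W)\le\mathcal M_\chi(W)$.
   Context: $(\mathcal X,\mathcal B,\mu)$ is a probability measure space and $\mathcal H=L^2(\mathcal X,\mu)$ (complex-valued). For $X\in\mathcal B$, $\pi_X:\mathcal H\to\mathcal H$ is the orthogonal projector $\pi_Xf=\mathbf 1_X f$. A partition is a finite family $\chi=\{Y_1,\dots,Y_J\}\subset\mathcal B$ with $\mu(\mathcal X\setminus\bigcup_j Y_j)=0$ and $\mu(Y_j\cap Y_k)=0$ for $j\ne k$. A partition $\chi'$ is a subpartition of $\chi$ if it refines $\chi$, i.e. every element of $\chi'$ is contained (up to a $\mu$-null set) in some element of $\chi$. For a bounded operator $W$ on $\mathcal H$ with operator norm $\|W\|$, $\mathcal M_\chi(W)=\sum_{j=1}^J\mu(Y_j)\|W\pi_{Y_j}\|^2$. *)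

theory Defs
  imports "HOL-Probability.Probability"
begin

text \<open>
  The space \<open>L\<^sup>2(M)\<close> of complex-valued functions depends on the measure \<open>M\<close>, so it is
  given as a carrier set: the square-integrable functions modulo equality almost everywhere.
  Operators are functions on equivalence classes, of which only the values on the
  carrier \<open>L2 M\<close> are relevant.
\<close>

definition L2_fun :: "'a measure \<Rightarrow> ('a \<Rightarrow> complex) set" where
  "L2_fun M = {f \<in> borel_measurable M. integrable M (\<lambda>x. (cmod (f x))\<^sup>2)}"

definition L2_rel :: "'a measure \<Rightarrow> (('a \<Rightarrow> complex) \<times> ('a \<Rightarrow> complex)) set" where
  "L2_rel M = {(f, g). f \<in> L2_fun M \<and> g \<in> L2_fun M \<and> (AE x in M. f x = g x)}"

definition L2 :: "'a measure \<Rightarrow> ('a \<Rightarrow> complex) set set" where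
  "L2 M = L2_fun M // L2_rel M"

definition L2_add ::
    "'a measure \<Rightarrow> ('a \<Rightarrow> complex) set \<Rightarrow> ('a \<Rightarrow> complex) set \<Rightarrow> ('a \<Rightarrow> complex) set" where
  "L2_add M u v = (\<Union>f\<in>u. \<Union>g\<in>v. L2_rel M `` {\<lambda>x. f x + g x})"

definition L2_scale ::
    "'a measure \<Rightarrow> complex \<Rightarrow> ('a \<Rightarrow> complex) set \<Rightarrow> ('a \<Rightarrow> complex) set" where
  "L2_scale M c u = (\<Union>f\<in>u. L2_rel M `` {\<lambda>x. c * f x})"

text \<open>All representatives of a class have the same norm, so the image below is a singleton.\<close>

definition L2_norm :: "'a measure \<Rightarrow> ('a \<Rightarrow> complex) set \<Rightarrow> real" where
  "L2_norm M u = the_elem ((\<lambda>f. sqrt (\<integral>x. (cmod (f x))\<^sup>2 \<partial>M)) ` u)"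

definition L2_proj ::
    "'a measure \<Rightarrow> 'a set \<Rightarrow> ('a \<Rightarrow> complex) set \<Rightarrow> ('a \<Rightarrow> complex) set" where
  "L2_proj M X u = (\<Union>f\<in>u. L2_rel M `` {\<lambda>x. indicator X x * f x})"

definition bounded_operator ::
    "'a measure \<Rightarrow> (('a \<Rightarrow> complex) set \<Rightarrow> ('a \<Rightarrow> complex) set) \<Rightarrow> bool" where
  "bounded_operator M W \<longleftrightarrow>
     W \<in> L2 M \<rightarrow> L2 M \<and>
     (\<forall>u\<in>L2 M. \<forall>v\<in>L2 M. W (L2_add M u v) = L2_add M (W u) (W v)) \<and>
     (\<forall>c. \<forall>u\<in>L2 M. W (L2_scale M c u) = L2_scale M c (W u)) \<and>
     (\<exists>C. \<forall>u\<in>L2 M. L2_norm M (W u) \<le> C * L2_norm M u)"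

definition operator_norm ::
    "'a measure \<Rightarrow> (('a \<Rightarrow> complex) set \<Rightarrow> ('a \<Rightarrow> complex) set) \<Rightarrow> real" where
  "operator_norm M W = (SUP u\<in>{u \<in> L2 M. L2_norm M u \<le> 1}. L2_norm M (W u))"

text \<open>
  A finite family \<open>Y\<^sub>1, \<dots>, Y\<^sub>J\<close> is a list of sets; null sets may occur repeatedly in it.
\<close>

definition is_partition :: "'a measure \<Rightarrow> 'a set list \<Rightarrow> bool" where
  "is_partition M Y \<longleftrightarrow>
     set Y \<subseteq> sets M \<and>
     measure M (space M - \<Union>(set Y)) = 0 \<and>
     (\<forall>j<length Y. \<forall>k<length Y. j \<noteq> k \<longrightarrow> measure M (Y ! j \<inter> Y ! k) = 0)"

definition is_subpartition :: "'a measure \<Rightarrow> 'a set list \<Rightarrow> 'a set list \<Rightarrow> bool" where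
  "is_subpartition M Y' Y \<longleftrightarrow> (\<forall>A\<in>set Y'. \<exists>B\<in>set Y. measure M (A - B) = 0)"

definition partition_sum ::
    "'a measure \<Rightarrow> 'a set list \<Rightarrow> (('a \<Rightarrow> complex) set \<Rightarrow> ('a \<Rightarrow> complex) set) \<Rightarrow> real" where
  "partition_sum M Y W =
     (\<Sum>j<length Y. measure M (Y ! j) * (operator_norm M (W \<circ> L2_proj M (Y ! j)))\<^sup>2)"


text \<open>The operations on classes are those induced by representatives.\<close>

lemma equiv_L2_rel: "equiv (L2_fun M) (L2_rel M)"
proof (rule equivI)
  show "L2_rel M \<subseteq> L2_fun M \<times> L2_fun M" by (auto simp: L2_rel_def)
  show "refl_on (L2_fun M) (L2_rel M)"
    by (auto simp: refl_on_def L2_rel_def)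
  show "sym (L2_rel M)"
    by (auto simp: sym_def L2_rel_def elim!: eventually_mono)
  have "AE x in M. f x = h x"
    if "AE x in M. f x = g x" "AE x in M. g x = h x" for f g h :: "'a \<Rightarrow> complex"
    using that by eventually_elim simp
  then show "trans (L2_rel M)"
    unfolding trans_def L2_rel_def by blast
qed

lemma L2_fun_add:
  assumes "f \<in> L2_fun M" "g \<in> L2_fun M"
  shows "(\<lambda>x. f x + g x) \<in> L2_fun M"
proof -
  have [measurable]: "f \<in> borel_measurable M" "g \<in> borel_measurable M"
    using assms by (auto simp: L2_fun_def)
  have *: "(cmod (a + b))\<^sup>2 \<le> 2 * (cmod a)\<^sup>2 + 2 * (cmod b)\<^sup>2" for a b :: complex
  proof -
    have "(cmod (a + b))\<^sup>2 \<le> (cmod a + cmod b)\<^sup>2"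
      by (intro power_mono norm_triangle_ineq) auto
    also have "\<dots> \<le> 2 * (cmod a)\<^sup>2 + 2 * (cmod b)\<^sup>2"
      using zero_le_power2[of "cmod a - cmod b"] unfolding power2_sum power2_diff by linarith
    finally show ?thesis .
  qed
  have "integrable M (\<lambda>x. 2 * (cmod (f x))\<^sup>2 + 2 * (cmod (g x))\<^sup>2)"
    using assms by (auto simp: L2_fun_def)
  then have "integrable M (\<lambda>x. (cmod (f x + g x))\<^sup>2)"
    by (rule Bochner_Integration.integrable_bound) (simp_all add: *)
  then show ?thesis by (auto simp: L2_fun_def)
qed

lemma L2_fun_scale: "f \<in> L2_fun M \<Longrightarrow> (\<lambda>x. c * f x) \<in> L2_fun M"
  by (auto simp: L2_fun_def norm_mult power_mult_distrib)

lemma L2_fun_indicator: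
  assumes "f \<in> L2_fun M" "X \<in> sets M"
  shows "(\<lambda>x. indicator X x * f x) \<in> L2_fun M"
proof -
  have [measurable]: "f \<in> borel_measurable M" "X \<in> sets M"
    using assms by (auto simp: L2_fun_def)
  have "integrable M (\<lambda>x. (cmod (f x))\<^sup>2)"
    using assms by (auto simp: L2_fun_def)
  then have "integrable M (\<lambda>x. (cmod (indicator X x * f x))\<^sup>2)"
    by (rule Bochner_Integration.integrable_bound) (auto simp: indicator_def)
  then show ?thesis by (auto simp: L2_fun_def)
qed

lemma L2_norm_class:
  assumes "f \<in> L2_fun M"
  shows "L2_norm M (L2_rel M `` {f}) = sqrt (\<integral>x. (cmod (f x))\<^sup>2 \<partial>M)"
proof -
  have "(\<integral>x. (cmod (g x))\<^sup>2 \<partial>M) = (\<integral>x. (cmod (f x))\<^sup>2 \<partial>M)" if "(f, g) \<in> L2_rel M" for g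
  proof (rule integral_cong_AE)
    show "AE x in M. (cmod (g x))\<^sup>2 = (cmod (f x))\<^sup>2"
      using that by (auto simp: L2_rel_def elim: eventually_mono)
  qed (use that in \<open>auto simp: L2_rel_def L2_fun_def\<close>)
  moreover have "f \<in> L2_rel M `` {f}"
    by (rule equiv_class_self[OF equiv_L2_rel assms])
  ultimately have "(\<lambda>f. sqrt (\<integral>x. (cmod (f x))\<^sup>2 \<partial>M)) ` (L2_rel M `` {f})
      = (\<lambda>g. sqrt (\<integral>x. (cmod (f x))\<^sup>2 \<partial>M)) ` (L2_rel M `` {f})"
    by (intro image_cong refl arg_cong[where f = sqrt]) blast
  also have "\<dots> = {sqrt (\<integral>x. (cmod (f x))\<^sup>2 \<partial>M)}"
    using \<open>f \<in> L2_rel M `` {f}\<close> by (simp only: image_constant)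
  finally show ?thesis by (simp add: L2_norm_def)
qed

lemma L2_add_class:
  assumes "f \<in> L2_fun M" "g \<in> L2_fun M"
  shows "L2_add M (L2_rel M `` {f}) (L2_rel M `` {g}) = L2_rel M `` {\<lambda>x. f x + g x}"
proof -
  have *: "AE x in M. f x + g x = f' x + g' x"
    if "AE x in M. f x = f' x" "AE x in M. g x = g' x" for f f' g g' :: "'a \<Rightarrow> complex"
    using that by eventually_elim simp
  have "(\<lambda>f g. L2_rel M `` {\<lambda>x. f x + g x}) respects2 L2_rel M"
    unfolding congruent2_def
    by (auto intro!: equiv_class_eq[OF equiv_L2_rel] simp: L2_rel_def L2_fun_add *)
  from UN_equiv_class2[OF equiv_L2_rel equiv_L2_rel this assms]
  show ?thesis by (simp add: L2_add_def)
qed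

lemma L2_scale_class:
  assumes "f \<in> L2_fun M"
  shows "L2_scale M c (L2_rel M `` {f}) = L2_rel M `` {\<lambda>x. c * f x}"
proof -
  have "(\<lambda>f. L2_rel M `` {\<lambda>x. c * f x}) respects L2_rel M"
    unfolding congruent_def
    by (auto intro!: equiv_class_eq[OF equiv_L2_rel] simp: L2_rel_def L2_fun_scale)
  from UN_equiv_class[OF equiv_L2_rel this assms]
  show ?thesis by (simp add: L2_scale_def)
qed

lemma L2_proj_class:
  assumes "f \<in> L2_fun M" "X \<in> sets M"
  shows "L2_proj M X (L2_rel M `` {f}) = L2_rel M `` {\<lambda>x. indicator X x * f x}"
proof -
  have "(\<lambda>f. L2_rel M `` {\<lambda>x. indicator X x * f x}) respects L2_rel M"
    unfolding congruent_def using assms(2)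
    by (auto intro!: equiv_class_eq[OF equiv_L2_rel] simp: L2_rel_def L2_fun_indicator
        elim: eventually_mono)
  from UN_equiv_class[OF equiv_L2_rel this assms(1)]
  show ?thesis by (simp add: L2_proj_def)
qed

end

theory Submission
  imports Defs
begin

text \<open>
  If \<open>A \<subseteq> B\<close> up to a null set, then \<open>\<pi>\<^sub>A = \<pi>\<^sub>B \<pi>\<^sub>A\<close> and \<open>\<pi>\<^sub>A\<close> is a contraction, so
  \<open>\<parallel>W \<pi>\<^sub>A\<parallel> \<le> \<parallel>W \<pi>\<^sub>B\<parallel>\<close>. Assign to each set of the finer partition a set of the coarser one that
  contains it almost everywhere; the sets assigned to a given \<open>B\<close> are almost disjoint, so their
  measures add up to at most the measure of \<open>B\<close>.
\<close>

lemma L2E: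
  assumes "u \<in> L2 M"
  obtains f where "f \<in> L2_fun M" "u = L2_rel M `` {f}"
  using assms unfolding L2_def by (auto elim: quotientE)

lemma L2_class: "f \<in> L2_fun M \<Longrightarrow> L2_rel M `` {f} \<in> L2 M"
  unfolding L2_def by (rule quotientI)

lemma L2_proj_in_L2: "u \<in> L2 M \<Longrightarrow> X \<in> sets M \<Longrightarrow> L2_proj M X u \<in> L2 M"
  by (elim L2E) (simp add: L2_proj_class L2_class L2_fun_indicator)

lemma L2_norm_nonneg: "u \<in> L2 M \<Longrightarrow> 0 \<le> L2_norm M u"
  by (elim L2E) (simp add: L2_norm_class)

lemma L2_norm_proj_le:
  assumes "u \<in> L2 M" "X \<in> sets M"
  shows "L2_norm M (L2_proj M X u) \<le> L2_norm M u"
proof -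
  obtain f where f: "f \<in> L2_fun M" "u = L2_rel M `` {f}"
    using assms(1) by (rule L2E)
  have "(\<lambda>x. indicator X x * f x) \<in> L2_fun M"
    using f(1) assms(2) by (rule L2_fun_indicator)
  then have "(\<integral>x. (cmod (indicator X x * f x))\<^sup>2 \<partial>M) \<le> (\<integral>x. (cmod (f x))\<^sup>2 \<partial>M)"
    using f(1) by (intro integral_mono) (auto simp: L2_fun_def indicator_def)
  then show ?thesis
    using f assms(2) by (simp add: L2_proj_class L2_norm_class L2_fun_indicator)
qed

text \<open>The two representatives can differ only on \<open>A - B\<close>, a null set. This yields
  the factorisation of \<open>W \<circ> L2_proj M A\<close> through
  \<open>W \<circ> L2_proj M B\<close>.\<close>

lemma L2_proj_absorb:
  assumes "u \<in> L2 M" "A \<in> sets M" "B \<in> sets M" "AE x in M. x \<in> A \<longrightarrow> x \<in> B"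
  shows "L2_proj M B (L2_proj M A u) = L2_proj M A u"
proof -
  obtain f where f: "f \<in> L2_fun M" "u = L2_rel M `` {f}"
    using assms(1) by (rule L2E)
  have "AE x in M. indicator B x * (indicator A x * f x) = indicator A x * f x"
    using assms(4) by eventually_elim (auto simp: indicator_def)
  then have "(\<lambda>x. indicator B x * (indicator A x * f x), \<lambda>x. indicator A x * f x) \<in> L2_rel M"
    using f(1) assms(2,3) by (auto simp: L2_rel_def intro!: L2_fun_indicator)
  then show ?thesis
    using f assms(2,3) by (simp add: L2_proj_class L2_fun_indicator equiv_class_eq[OF equiv_L2_rel])
qed

lemma L2_ball_nonempty: "{u \<in> L2 M. L2_norm M u \<le> 1} \<noteq> {}"
proof -
  have "(\<lambda>x. 0) \<in> L2_fun M"
    by (simp add: L2_fun_def)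
  then have "L2_rel M `` {\<lambda>x. 0} \<in> {u \<in> L2 M. L2_norm M u \<le> 1}"
    by (simp add: L2_class L2_norm_class)
  then show ?thesis by blast
qed

text \<open>The reals are only conditionally complete, so the supremum in
  \<open>operator_norm\<close> can be estimated only once its range is known to be bounded
  above.\<close>

lemma bdd_above_L2_norm_ball:
  assumes W: "bounded_operator M W" and X: "X \<in> sets M"
  shows "bdd_above ((\<lambda>u. L2_norm M ((W \<circ> L2_proj M X) u)) ` {u \<in> L2 M. L2_norm M u \<le> 1})"
proof -
  obtain C where C: "\<And>u. u \<in> L2 M \<Longrightarrow> L2_norm M (W u) \<le> C * L2_norm M u"
    using W unfolding bounded_operator_def by blast
  have "L2_norm M (W (L2_proj M X u)) \<le> \<bar>C\<bar>" if "u \<in> L2 M" "L2_norm M u \<le> 1" for u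
  proof -
    have "L2_norm M (W (L2_proj M X u)) \<le> C * L2_norm M (L2_proj M X u)"
      by (intro C L2_proj_in_L2 that X)
    \<comment> \<open>The sign of \<open>C\<close> is not prescribed, hence the absolute
      value.\<close>
    also have "\<dots> \<le> \<bar>C\<bar> * 1"
      using L2_norm_proj_le[OF that(1) X] L2_norm_nonneg[OF L2_proj_in_L2[OF that(1) X]] that(2)
      by (intro mult_mono) auto
    finally show ?thesis by simp
  qed
  then show ?thesis by (intro bdd_aboveI2) auto
qed

text \<open>The supremum dominates its value at any single point of the ball. Nonnegativity is what
  allows inequalities between operator norms to be squared.\<close>

lemma operator_norm_proj_nonneg:
  assumes W: "bounded_operator M W" and X: "X \<in> sets M"
  shows "0 \<le> operator_norm M (W \<circ> L2_proj M X)"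
proof -
  obtain u where u: "u \<in> {u \<in> L2 M. L2_norm M u \<le> 1}"
    using L2_ball_nonempty by blast
  then have "W (L2_proj M X u) \<in> L2 M"
    using W L2_proj_in_L2[OF _ X] unfolding bounded_operator_def by auto
  then have "0 \<le> L2_norm M ((W \<circ> L2_proj M X) u)"
    by (simp add: L2_norm_nonneg)
  also have "\<dots> \<le> operator_norm M (W \<circ> L2_proj M X)"
    unfolding operator_norm_def by (rule cSUP_upper[OF u bdd_above_L2_norm_ball[OF W X]])
  finally show ?thesis .
qed

lemma operator_norm_proj_mono:
  assumes W: "bounded_operator M W" and A: "A \<in> sets M" and B: "B \<in> sets M"
    and AB: "AE x in M. x \<in> A \<longrightarrow> x \<in> B"
  shows "operator_norm M (W \<circ> L2_proj M A) \<le> operator_norm M (W \<circ> L2_proj M B)"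
  unfolding operator_norm_def
proof (rule cSUP_mono[OF L2_ball_nonempty bdd_above_L2_norm_ball[OF W B]])
  fix u assume "u \<in> {u \<in> L2 M. L2_norm M u \<le> 1}"
  then have u: "u \<in> L2 M" "L2_norm M u \<le> 1" by auto
  show "\<exists>v\<in>{u \<in> L2 M. L2_norm M u \<le> 1}.
      L2_norm M ((W \<circ> L2_proj M A) u) \<le> L2_norm M ((W \<circ> L2_proj M B) v)"
    \<comment> \<open>The witness is the projection of \<open>u\<close> to \<open>A\<close>: it
      stays in the unit ball, and projecting it to \<open>B\<close> leaves it unchanged.\<close>
    using L2_norm_proj_le[OF u(1) A] L2_proj_in_L2[OF u(1) A] L2_proj_absorb[OF u(1) A B AB] u(2)
    by (intro bexI[of _ "L2_proj M A u"]) auto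
qed

text \<open>Almost every point lies in at most one \<open>A j\<close>, and then also in
  \<open>B\<close>. So the sum of the indicators is at most the indicator of \<open>B\<close> almost
  everywhere, and integration gives the claim.\<close>

lemma (in finite_measure) sum_measure_le_AE_disjoint:
  assumes "finite S" and A: "\<And>j. j \<in> S \<Longrightarrow> A j \<in> sets M" and B: "B \<in> sets M"
    and disj: "\<And>j k. j \<in> S \<Longrightarrow> k \<in> S \<Longrightarrow> j \<noteq> k \<Longrightarrow> AE x in M. x \<notin> A j \<inter> A k"
    and sub: "\<And>j. j \<in> S \<Longrightarrow> AE x in M. x \<in> A j \<longrightarrow> x \<in> B"
  shows "(\<Sum>j\<in>S. measure M (A j)) \<le> measure M B"
proof -
  have "AE x in M. \<forall>j\<in>S. \<forall>k\<in>S. j \<noteq> k \<longrightarrow> x \<notin> A j \<inter> A k"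
    using disj \<open>finite S\<close> by (intro AE_finite_allI) auto
  moreover have "AE x in M. \<forall>j\<in>S. x \<in> A j \<longrightarrow> x \<in> B"
    using sub \<open>finite S\<close> by (intro AE_finite_allI) auto
  ultimately have le: "AE x in M. (\<Sum>j\<in>S. indicator (A j) x) \<le> (indicator B x :: real)"
  proof eventually_elim
    case (elim x)
    show ?case
    proof (cases "\<exists>j\<in>S. x \<in> A j")
      case True
      then obtain j where j: "j \<in> S" "x \<in> A j" by blast
      have "(\<Sum>i\<in>S. indicator (A i) x) = (\<Sum>i\<in>S. if i = j then 1 else 0 :: real)"
        using elim(1) j by (intro sum.cong) (auto simp: indicator_def)
      moreover have "x \<in> B" using elim(2) j by blast
      ultimately show ?thesis using j \<open>finite S\<close> by simp
    qed simp
  qed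
  have "(\<Sum>j\<in>S. measure M (A j)) = (\<integral>x. (\<Sum>j\<in>S. indicator (A j) x) \<partial>M)"
    using A by (subst Bochner_Integration.integral_sum) (auto intro!: integrable_real_indicator simp: less_top[symmetric])
  also have "\<dots> \<le> (\<integral>x. indicator B x \<partial>M)"
    using A B le by (intro integral_mono_AE Bochner_Integration.integrable_sum integrable_real_indicator)
      (auto simp: less_top[symmetric])
  also have "\<dots> = measure M B"
    using B by simp
  finally show ?thesis .
qed

theorem corollary2p1:
  fixes M :: "'a measure"
    and W :: "('a \<Rightarrow> complex) set \<Rightarrow> ('a \<Rightarrow> complex) set"
    and Y Y' :: "'a set list"
  assumes "prob_space M"
    and "bounded_operator M W"
    and "is_partition M Y"
    and "is_partition M Y'"
    and "is_subpartition M Y' Y"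
  shows "partition_sum M Y' W \<le> partition_sum M Y W"
proof -
  interpret prob_space M by fact
  define N where "N X = (operator_norm M (W \<circ> L2_proj M X))\<^sup>2" for X
  have Y: "Y ! k \<in> sets M" if "k < length Y" for k
    using assms(3) that unfolding is_partition_def by auto
  have Y': "Y' ! j \<in> sets M" if "j < length Y'" for j
    using assms(4) that unfolding is_partition_def by auto
  \<comment> \<open>The real-valued \<open>measure\<close> is 0 on sets of infinite measure too;
    here finiteness of \<open>M\<close> makes the value 0 mean a null set.\<close>
  have null: "AE x in M. x \<notin> X" if "measure M X = 0" "X \<in> sets M" for X
    using that by (intro AE_not_in) (simp add: null_sets_def emeasure_eq_measure)
  have "\<exists>k<length Y. AE x in M. x \<in> Y' ! j \<longrightarrow> x \<in> Y ! k" if j: "j < length Y'" for j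
  proof -
    obtain k where k: "k < length Y" "measure M (Y' ! j - Y ! k) = 0"
      using assms(5) j unfolding is_subpartition_def by (metis in_set_conv_nth)
    have "AE x in M. x \<notin> Y' ! j - Y ! k"
      using k Y Y'[OF j] by (intro null) auto
    then show ?thesis using k(1) by auto
  qed
  \<comment> \<open>The choice is made on indices rather than sets, as null sets may be repeated in
    the lists. A null \<open>Y' ! j\<close> may fit several \<open>Y ! k\<close>; any choice will
    do.\<close>
  then obtain b where b: "\<And>j. j < length Y' \<Longrightarrow> b j < length Y"
      "\<And>j. j < length Y' \<Longrightarrow> AE x in M. x \<in> Y' ! j \<longrightarrow> x \<in> Y ! b j"
    by metis
  have disj: "AE x in M. x \<notin> Y' ! j \<inter> Y' ! k"
    if "j < length Y'" "k < length Y'" "j \<noteq> k" for j k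
    using assms(4) that Y' unfolding is_partition_def by (intro null) auto
  have "partition_sum M Y' W \<le> (\<Sum>j<length Y'. measure M (Y' ! j) * N (Y ! b j))"
    unfolding partition_sum_def N_def
    using b Y Y' assms(2)
    by (intro sum_mono mult_left_mono power_mono operator_norm_proj_mono
        operator_norm_proj_nonneg) auto
  \<comment> \<open>The terms are grouped by the fibres of \<open>b\<close>; on the fibre over
    \<open>k\<close> the factor \<open>N (Y ! b j)\<close> is the constant
    \<open>N (Y ! k)\<close>.\<close>
  also have "\<dots> = (\<Sum>k<length Y. \<Sum>j | j \<in> {..<length Y'} \<and> b j = k.
      measure M (Y' ! j) * N (Y ! b j))"
    using b(1) by (intro sum.group[symmetric]) auto
  also have "\<dots> = (\<Sum>k<length Y.
      (\<Sum>j | j \<in> {..<length Y'} \<and> b j = k. measure M (Y' ! j)) * N (Y ! k))"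
    by (simp add: sum_distrib_right)
  \<comment> \<open>Within each fibre the sets are almost disjoint and almost contained in
    \<open>Y ! k\<close>; the weight \<open>N (Y ! k)\<close> is nonnegative, being a
    square.\<close>
  also have "\<dots> \<le> (\<Sum>k<length Y. measure M (Y ! k) * N (Y ! k))"
    using b Y Y' disj
    by (intro sum_mono mult_right_mono sum_measure_le_AE_disjoint) (auto simp: N_def)
  also have "\<dots> = partition_sum M Y W"
    by (simp add: partition_sum_def N_def)
  finally show ?thesis .
qed

end
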